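(* Let $C_1$ and $C_2$ be two singular real symmetric $n\times n$ matrices, and let $p=\operatorname{rank}(C_1)<n$. Let $U_1$ be a nonsingular real matrix such that $\bar C_1=U_1^TC_1U_1$ and $\bar C_2=U_1^TC_2U_1$ have the form $$\bar C_1=\begin{pmatrix}C_{11}&0\\0&0_{n-p}\end{pmatrix},\qquad \bar C_2=\begin{pmatrix}C_{21}&C_{22}\\ C_{22}^T&0_{n-p}\end{pmatrix},$$ where $C_{11}$ is an invertible diagonal $p\times p$ matrix, $C_{21}$ is $p\times p$ and $C_{22}$ is $p\times(n-p)$. Then $\bar C_1$ and $\bar C_2$ are SDC if and only if $C_{11}$ and $C_{21}$ are SDC and $C_{22}=0_{p\times(n-p)}$.
   Context: A collection of real symmetric matrices of the same size is SDC (simultaneously diagonalizable via congruence) if there is a nonsingular real matrix $P$ such that $P^TMP$ is (real) diagonal for every matrix $M$ in the collection. $0_k$ denotes the $k\times k$ zero matrix. *)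

theory Defs
  imports "Jordan_Normal_Form.Matrix" "Jordan_Normal_Form.DL_Rank"
begin

(* Equality of matrices includes equality of dimensions, so this forces A to be square. *)
definition symmetric_mat :: "'a mat \<Rightarrow> bool" where
  "symmetric_mat A \<longleftrightarrow> transpose_mat A = A"

definition SDC :: "nat \<Rightarrow> real mat set \<Rightarrow> bool" where
  "SDC n S \<longleftrightarrow>
     (\<forall>M\<in>S. M \<in> carrier_mat n n \<and> symmetric_mat M) \<and>
     (\<exists>P \<in> carrier_mat n n. invertible_mat P \<and>
        (\<forall>M\<in>S. diagonal_mat (transpose_mat P * M * P)))"

end

theory Submission
  imports Defs
begin

text \<open>
  Write \<open>A\<close> and \<open>B\<close> for the two block matrices, viewed as quadratic forms. Since the block
  \<open>C11\<close> is invertible, the kernel of \<open>A\<close> consists of the vectors whose first \<open>p\<close> coordinates vanish,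
  and the zero corner of \<open>B\<close> says that every such vector is isotropic for \<open>B\<close>.

  Suppose that the columns of \<open>P\<close> diagonalize both forms. The kernel of \<open>A\<close> is spanned by those
  columns whose diagonal entry for \<open>A\<close> is zero. The diagonal entry for \<open>B\<close> at such a column is the
  value of the form \<open>B\<close> there, hence zero as well, and so \<open>B\<close> annihilates the column. Therefore the
  kernel of \<open>A\<close> lies in that of \<open>B\<close> (\<open>simultaneous_diagonal_ker_subset\<close>), which means
  \<open>C22 = 0\<close> (\<open>SDC_imp_off_diagonal_block_zero\<close>).

  Once \<open>C22 = 0\<close>, both matrices are zero-padded \<open>p \<times> p\<close> matrices, and it remains to see that
  padding does not affect SDC when one of the small matrices is invertible (\<open>SDC_zero_pad_iff\<close>).
  A diagonalizing \<open>Q\<close> for the small matrices extends by an identity block. Conversely the first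
  \<open>p\<close> rows \<open>X\<close> of \<open>P\<close> satisfy \<open>X\<^sup>T * M * X = P\<^sup>T * zero_pad p m M * P\<close>, so the columns of \<open>X\<close>
  are orthogonal for all the small forms, but there are too many of them. Those that are isotropic
  for \<open>C11\<close> are zero; the others span the whole space because \<open>X\<close> has rank \<open>p\<close>, and they are
  independent because their Gram matrix for \<open>C11\<close> is diagonal with nonzero entries. Hence they
  form a basis that diagonalizes all the small forms (\<open>SDC_of_surjective_congruence\<close>).
\<close>

section \<open>Inverses of rectangular matrices\<close>

lemma invertible_mat_of_right_inverse:
  fixes A :: "'a :: field mat"
  assumes A: "A \<in> carrier_mat n n" and B: "B \<in> carrier_mat n n" and AB: "A * B = 1\<^sub>m n"
  shows "invertible_mat A"
  using mat_mult_left_right_inverse[OF A B AB] A B AB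
  unfolding invertible_mat_def inverts_mat_def by auto

lemma invertible_mat_obtain_inverse:
  assumes inv: "invertible_mat A" and A: "A \<in> carrier_mat n n"
  obtains B where "B \<in> carrier_mat n n" and "A * B = 1\<^sub>m n" and "B * A = 1\<^sub>m n"
proof -
  obtain B where AB: "A * B = 1\<^sub>m n" and BA: "B * A = 1\<^sub>m (dim_row B)"
    using inv A unfolding invertible_mat_def inverts_mat_def by auto
  have "dim_col B = n" using arg_cong[OF AB, of dim_col] by simp
  moreover have "dim_row B = n" using arg_cong[OF BA, of dim_col] A by simp
  ultimately show ?thesis using that[of B] AB BA by auto
qed

text \<open>If \<open>b < a\<close>, filling both factors up with zeros to size \<open>a\<close> would keep
  the product but give the right factor a zero row, so the two could not be mutually inverse.\<close>

lemma right_inverse_imp_rows_le_cols: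
  fixes X Y :: "'a :: field mat"
  assumes X: "X \<in> carrier_mat a b" and Y: "Y \<in> carrier_mat b a" and XY: "X * Y = 1\<^sub>m a"
  shows "a \<le> b"
proof (rule ccontr)
  assume "\<not> a \<le> b"
  hence ba: "b < a" by simp
  define X' where "X' = mat a a (\<lambda>(i,j). if j < b then X $$ (i,j) else 0)"
  define Y' where "Y' = mat a a (\<lambda>(i,j). if i < b then Y $$ (i,j) else 0)"
  have carr: "X' \<in> carrier_mat a a" "Y' \<in> carrier_mat a a"
    unfolding X'_def Y'_def by auto
  have "X' * Y' = X * Y"
  proof (rule eq_matI)
    fix i j assume "i < dim_row (X * Y)" and "j < dim_col (X * Y)"
    hence ij: "i < a" "j < a" using X Y by auto
    have "(X' * Y') $$ (i,j) = (\<Sum>k\<in>{0..<a}. if k < b then X $$ (i,k) * Y $$ (k,j) else 0)"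
      using ij carr by (auto simp: scalar_prod_def X'_def Y'_def intro!: sum.cong)
    also have "\<dots> = (\<Sum>k\<in>{0..<b}. X $$ (i,k) * Y $$ (k,j))"
      using ba by (intro sum.mono_neutral_cong_right) auto
    also have "\<dots> = (X * Y) $$ (i,j)" using ij X Y by (auto simp: scalar_prod_def)
    finally show "(X' * Y') $$ (i,j) = (X * Y) $$ (i,j)" .
  qed (use X Y carr in auto)
  hence "Y' * X' = 1\<^sub>m a" using mat_mult_left_right_inverse[OF carr] XY by simp
  hence "(Y' * X') $$ (b,b) = 1" using ba by simp
  moreover have "(Y' * X') $$ (b,b) = 0"
    using ba carr by (auto simp: scalar_prod_def Y'_def)
  ultimately show False by simp
qed

section \<open>Kernels of simultaneously diagonalized forms\<close>

lemma mult_mat_zero_vec: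
  fixes A :: "'a :: semiring_0 mat"
  assumes "A \<in> carrier_mat nr n"
  shows "A *\<^sub>v 0\<^sub>v n = 0\<^sub>v nr"
  using assms by (intro eq_vecI) auto

lemma mult_mat_vec_unit_vec:
  fixes A :: "'a :: semiring_1 mat"
  assumes "A \<in> carrier_mat nr n" and "i < n"
  shows "A *\<^sub>v unit_vec n i = col A i"
  using assms by (intro eq_vecI) auto

lemma diagonal_mat_col_zero:
  assumes "D \<in> carrier_mat n n" and "diagonal_mat D" and "i < n" and "D $$ (i,i) = 0"
  shows "col D i = 0\<^sub>v n"
proof (rule eq_vecI)
  fix k assume "k < dim_vec (0\<^sub>v n)"
  thus "col D i $ k = 0\<^sub>v n $ k"
    using assms unfolding diagonal_mat_def by (cases "k = i") auto
qed (use assms in auto)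

text \<open>In coordinates with respect to the columns of \<open>P\<close> both forms are diagonal, so both kernels
  are coordinate subspaces. It is therefore enough to compare diagonal entries: at a column in the
  kernel of \<open>A\<close>, the entry for \<open>B\<close> is the value of the form \<open>B\<close>, which isotropy makes zero.\<close>

lemma simultaneous_diagonal_ker_subset:
  fixes A B P :: "'a :: field mat"
  assumes A: "A \<in> carrier_mat n n" and B: "B \<in> carrier_mat n n"
    and P: "P \<in> carrier_mat n n" and Pinv: "invertible_mat P"
    and DA: "diagonal_mat (transpose_mat P * A * P)"
    and DB: "diagonal_mat (transpose_mat P * B * P)"
    and isotropic: "\<And>x. x \<in> carrier_vec n \<Longrightarrow> A *\<^sub>v x = 0\<^sub>v n \<Longrightarrow> x \<bullet> (B *\<^sub>v x) = 0"
    and v: "v \<in> carrier_vec n" and Av: "A *\<^sub>v v = 0\<^sub>v n"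
  shows "B *\<^sub>v v = 0\<^sub>v n"
proof -
  obtain R where R: "R \<in> carrier_mat n n" and PR: "P * R = 1\<^sub>m n" and RP: "R * P = 1\<^sub>m n"
    using invertible_mat_obtain_inverse[OF Pinv P] by blast
  have Pt: "transpose_mat P \<in> carrier_mat n n" and Rt: "transpose_mat R \<in> carrier_mat n n"
    using P R by auto
  have RtPt: "transpose_mat R * transpose_mat P = 1\<^sub>m n"
    using transpose_mult[OF P R] PR by simp
  have cong: "transpose_mat P * M * P *\<^sub>v x = transpose_mat P *\<^sub>v (M *\<^sub>v (P *\<^sub>v x))"
    if "M \<in> carrier_mat n n" "x \<in> carrier_vec n" for M x
    using that P Pt by (simp add: assoc_mult_mat_vec[of _ n n _ n])
  have cancel: "y = 0\<^sub>v n"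
    if y: "y \<in> carrier_vec n" and y0: "transpose_mat P *\<^sub>v y = 0\<^sub>v n" for y
  proof -
    have "y = transpose_mat R *\<^sub>v (transpose_mat P *\<^sub>v y)"
      using assoc_mult_mat_vec[OF Rt Pt y] RtPt y by simp
    also have "\<dots> = 0\<^sub>v n" unfolding y0 using Rt by (rule mult_mat_zero_vec)
    finally show ?thesis .
  qed
  define DA' where "DA' = transpose_mat P * A * P"
  define DB' where "DB' = transpose_mat P * B * P"
  have DA': "DA' \<in> carrier_mat n n" and DB': "DB' \<in> carrier_mat n n"
    unfolding DA'_def DB'_def using P A B by auto
  have diag: "DB' $$ (i,i) = 0" if i: "i < n" and i0: "DA' $$ (i,i) = 0" for i
  proof -
    let ?e = "unit_vec n i :: 'a vec"
    let ?x = "P *\<^sub>v ?e"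
    have x: "?x \<in> carrier_vec n" using P by simp
    have "col DA' i = 0\<^sub>v n"
      using diagonal_mat_col_zero[OF DA' _ i i0] DA by (simp add: DA'_def)
    hence "transpose_mat P *\<^sub>v (A *\<^sub>v ?x) = 0\<^sub>v n"
      using cong[OF A, of ?e] mult_mat_vec_unit_vec[OF DA' i] by (simp add: DA'_def)
    hence "A *\<^sub>v ?x = 0\<^sub>v n" using cancel A x by simp
    hence "0 = ?x \<bullet> (B *\<^sub>v ?x)" using isotropic x by simp
    also have "\<dots> = ?e \<bullet> (transpose_mat P *\<^sub>v (B *\<^sub>v ?x))"
      using transpose_vec_mult_scalar[of P n n ?e "B *\<^sub>v ?x"] P B x
      by (metis comm_scalar_prod mult_mat_vec_carrier transpose_carrier_mat unit_vec_carrier)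
    also have "\<dots> = ?e \<bullet> col DB' i"
      using cong[OF B, of ?e] mult_mat_vec_unit_vec[OF DB' i] by (simp add: DB'_def)
    also have "\<dots> = DB' $$ (i,i)" using i DB' by simp
    finally show ?thesis by simp
  qed
  define y where "y = R *\<^sub>v v"
  have y: "y \<in> carrier_vec n" using R v y_def by simp
  have Py: "P *\<^sub>v y = v"
    using assoc_mult_mat_vec[OF P R v] PR v y_def by simp
  have entry: "(D *\<^sub>v y) $ i = D $$ (i,i) * y $ i"
    if D: "D \<in> carrier_mat n n" "diagonal_mat D" and i: "i < n" for D i
  proof -
    have "(D *\<^sub>v y) $ i = (\<Sum>k\<in>{0..<n}. D $$ (i,k) * y $ k)"
      using D i y by (auto simp: scalar_prod_def)
    also have "\<dots> = (\<Sum>k\<in>{i}. D $$ (i,k) * y $ k)"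
      using D i unfolding diagonal_mat_def by (intro sum.mono_neutral_right) auto
    finally show ?thesis by simp
  qed
  have "DA' *\<^sub>v y = 0\<^sub>v n"
    using cong[OF A y] Py Av Pt by (simp add: DA'_def mult_mat_zero_vec)
  hence "DA' $$ (i,i) * y $ i = 0" if "i < n" for i
    using entry[OF DA' _ that] DA that by (simp add: DA'_def)
  hence "DB' *\<^sub>v y = 0\<^sub>v n"
    using diag entry[OF DB'] DB DB' by (intro eq_vecI) (auto simp: DB'_def)
  hence "transpose_mat P *\<^sub>v (B *\<^sub>v v) = 0\<^sub>v n"
    using cong[OF B y] Py by (simp add: DB'_def)
  thus ?thesis using cancel B v by simp
qed

section \<open>Compression to the nonsingular block\<close>

lemma congruence_columns:
  fixes X M :: "'a :: comm_semiring_0 mat"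
  assumes X: "X \<in> carrier_mat p n" and M: "M \<in> carrier_mat p p"
    and f: "\<And>j. j < m \<Longrightarrow> f j < n"
    and Q: "Q = mat p m (\<lambda>(a,j). X $$ (a, f j))"
    and i: "i < m" and j: "j < m"
  shows "(transpose_mat Q * M * Q) $$ (i,j) = (transpose_mat X * M * X) $$ (f i, f j)"
proof -
  have c: "col Q k = col X (f k)" if "k < m" for k
    using that X f Q by (intro eq_vecI) auto
  have "row (transpose_mat Q * M) i = row (transpose_mat X * M) (f i)"
    using i X M f Q c[OF i] by (intro eq_vecI) auto
  moreover have "(transpose_mat Q * M * Q) $$ (i,j) = row (transpose_mat Q * M) i \<bullet> col Q j"
    by (rule index_mult_mat(1)) (use i j Q in auto)
  moreover have "(transpose_mat X * M * X) $$ (f i, f j) = row (transpose_mat X * M) (f i) \<bullet> col X (f j)"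
    by (rule index_mult_mat(1)) (use i j X f in auto)
  ultimately show ?thesis using c[OF j] by simp
qed

text \<open>The columns of \<open>X\<close> span the space and are orthogonal for every form in \<open>S\<close>. Orthogonality for
  the nondegenerate form \<open>C\<close> leaves a basis once the zero columns are dropped: a column that is
  isotropic for \<open>C\<close> is orthogonal to the whole span and thus zero.\<close>

lemma SDC_of_surjective_congruence:
  fixes X R C :: "real mat"
  assumes S: "\<And>M. M \<in> S \<Longrightarrow> M \<in> carrier_mat p p \<and> symmetric_mat M"
    and C: "C \<in> S" and Cinv: "invertible_mat C"
    and X: "X \<in> carrier_mat p n" and R: "R \<in> carrier_mat n p" and XR: "X * R = 1\<^sub>m p"
    and diag: "\<And>M. M \<in> S \<Longrightarrow> diagonal_mat (transpose_mat X * M * X)"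
  shows "SDC p S"
proof -
  have Cc: "C \<in> carrier_mat p p" using S C by blast
  obtain K where K: "K \<in> carrier_mat p p" and KC: "K * C = 1\<^sub>m p"
    using invertible_mat_obtain_inverse[OF Cinv Cc] by blast
  define D where "D = transpose_mat X * C * X"
  have D: "D \<in> carrier_mat n n" unfolding D_def using X by auto
  have Ddiag: "i < n \<Longrightarrow> j < n \<Longrightarrow> i \<noteq> j \<Longrightarrow> D $$ (i,j) = 0" for i j
    using diag[OF C] D unfolding D_def[symmetric] diagonal_mat_def by auto
  have Xt: "transpose_mat X \<in> carrier_mat n p" and Rt: "transpose_mat R \<in> carrier_mat p n"
    using X R by auto
  have RtXt: "transpose_mat R * transpose_mat X = 1\<^sub>m p"
    using transpose_mult[OF X R] XR by simp
  have "transpose_mat R * D = (transpose_mat R * transpose_mat X) * (C * X)"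
    unfolding D_def using Xt Rt Cc X
    by (simp add: assoc_mult_mat[of _ p n _ p _ n] assoc_mult_mat[of _ n p _ p _ n])
  hence "transpose_mat R * D = C * X" using RtXt Cc X by simp
  hence "K * (transpose_mat R * D) = (K * C) * X"
    using assoc_mult_mat[OF K Cc X] by simp
  \<comment> \<open>Expressing \<open>X\<close> as a multiple of \<open>D\<close> turns every zero column of \<open>D\<close> into one of \<open>X\<close>.\<close>
  hence XD: "X = (K * transpose_mat R) * D"
    using KC X assoc_mult_mat[OF K Rt D] by simp
  have X0: "X $$ (a,i) = 0" if a: "a < p" and i: "i < n" and i0: "D $$ (i,i) = 0" for a i
  proof -
    have "X $$ (a,i) = row (K * transpose_mat R) a \<bullet> col D i"
      by (subst XD, rule index_mult_mat(1)) (use a i K Rt D in auto)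
    also have "col D i = 0\<^sub>v n"
      using diagonal_mat_col_zero[OF D _ i i0] diag[OF C] by (simp add: D_def)
    finally show ?thesis using K Rt a by simp
  qed
  define I where "I = {i. i < n \<and> D $$ (i,i) \<noteq> 0}"
  define m where "m = card I"
  have "finite I" unfolding I_def by simp
  then obtain f where f: "bij_betw f {0..<m} I"
    using ex_bij_betw_nat_finite unfolding m_def by blast
  have fI: "f j < n" "D $$ (f j, f j) \<noteq> 0" if "j < m" for j
    using bij_betwE[OF f] that unfolding I_def by auto
  have f_inj: "f i = f j \<longleftrightarrow> i = j" if "i < m" "j < m" for i j
    using f that unfolding bij_betw_def by (auto dest: inj_onD)
  \<comment> \<open>\<open>Q\<close> keeps the nonzero columns of \<open>X\<close>, and \<open>T\<close> the matching rows of its right inverse.\<close>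
  define Q where "Q = mat p m (\<lambda>(a,j). X $$ (a, f j))"
  define T where "T = mat m p (\<lambda>(j,b). R $$ (f j, b))"
  have Q: "Q \<in> carrier_mat p m" and T: "T \<in> carrier_mat m p" unfolding Q_def T_def by auto
  have Qdiag: "diagonal_mat (transpose_mat Q * M * Q)" if "M \<in> S" for M
    unfolding diagonal_mat_def
  proof (intro allI impI)
    fix i j assume "i < dim_row (transpose_mat Q * M * Q)" "j < dim_col (transpose_mat Q * M * Q)"
      and ne: "i \<noteq> j"
    hence ij: "i < m" "j < m" using Q by auto
    have "(transpose_mat Q * M * Q) $$ (i,j) = (transpose_mat X * M * X) $$ (f i, f j)"
      using S[OF that] ij fI by (intro congruence_columns[OF X _ _ Q_def]) auto
    also have "\<dots> = 0"
      using diag[OF that] ij ne fI(1) f_inj X unfolding diagonal_mat_def by auto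
    finally show "(transpose_mat Q * M * Q) $$ (i,j) = 0" .
  qed
  have QT: "Q * T = 1\<^sub>m p"
  proof -
    have "Q * T = X * R"
    proof (rule eq_matI)
      fix a b assume "a < dim_row (X * R)" "b < dim_col (X * R)"
      hence ab: "a < p" "b < p" using X R by auto
      have "(Q * T) $$ (a,b) = (\<Sum>j\<in>{0..<m}. X $$ (a, f j) * R $$ (f j, b))"
        using ab Q T by (auto simp: scalar_prod_def Q_def T_def)
      also have "\<dots> = (\<Sum>i\<in>I. X $$ (a,i) * R $$ (i,b))"
        using sum.reindex_bij_betw[OF f, of "\<lambda>i. X $$ (a,i) * R $$ (i,b)"] by simp
      also have "\<dots> = (\<Sum>i\<in>{0..<n}. X $$ (a,i) * R $$ (i,b))"
        using X0[OF ab(1)] by (intro sum.mono_neutral_left) (auto simp: I_def)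
      also have "\<dots> = (X * R) $$ (a,b)" using ab X R by (auto simp: scalar_prod_def)
      finally show "(Q * T) $$ (a,b) = (X * R) $$ (a,b)" .
    qed (use X R Q T in auto)
    thus ?thesis using XR by simp
  qed
  have "p \<le> m" using right_inverse_imp_rows_le_cols[OF Q T QT] .
  \<comment> \<open>The reverse bound comes from a left inverse of \<open>Q\<close>, read off from its invertible Gram matrix.\<close>
  moreover have "m \<le> p"
  proof -
    define E where "E = transpose_mat Q * C * Q"
    define F where "F = mat m m (\<lambda>(i,j). if i = j then inverse (D $$ (f i, f i)) else 0)"
    have E: "E \<in> carrier_mat m m" and F: "F \<in> carrier_mat m m"
      unfolding E_def F_def using Q by auto
    have Eij: "E $$ (i,j) = (if i = j then D $$ (f i, f i) else 0)" if "i < m" "j < m" for i j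
      using congruence_columns[OF X Cc _ Q_def that] fI(1) f_inj that Ddiag
      unfolding E_def D_def[symmetric] by auto
    have "F * E = 1\<^sub>m m"
    proof (rule eq_matI)
      fix i j assume "i < dim_row (1\<^sub>m m)" "j < dim_col (1\<^sub>m m)"
      hence ij: "i < m" "j < m" by auto
      have "(F * E) $$ (i,j) = (\<Sum>k\<in>{0..<m}. F $$ (i,k) * E $$ (k,j))"
        using ij E F by (auto simp: scalar_prod_def)
      also have "\<dots> = (\<Sum>k\<in>{0..<m}. if k = i then inverse (D $$ (f i, f i)) * E $$ (i,j) else 0)"
        using ij by (intro sum.cong) (auto simp: F_def)
      also have "\<dots> = 1\<^sub>m m $$ (i,j)" using ij fI(2) by (simp add: Eij)
      finally show "(F * E) $$ (i,j) = 1\<^sub>m m $$ (i,j)" .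
    qed (use E F in auto)
    moreover have "F * E = (F * (transpose_mat Q * C)) * Q"
      unfolding E_def using F Q Cc by (simp add: assoc_mult_mat[of _ m m _ p _ m])
    ultimately have "(F * (transpose_mat Q * C)) * Q = 1\<^sub>m m" by simp
    thus ?thesis
      using right_inverse_imp_rows_le_cols[of "F * (transpose_mat Q * C)" m p Q] F Q Cc by auto
  qed
  ultimately have mp: "m = p" by simp
  have "invertible_mat Q"
    using invertible_mat_of_right_inverse[of Q p T] Q T QT mp by simp
  thus ?thesis unfolding SDC_def using S Q Qdiag mp by blast
qed

section \<open>Padding with zeros\<close>

definition zero_pad :: "nat \<Rightarrow> nat \<Rightarrow> 'a :: zero mat \<Rightarrow> 'a mat" where
  "zero_pad p m M = four_block_mat M (0\<^sub>m p m) (0\<^sub>m m p) (0\<^sub>m m m)"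

lemma zero_pad_carrier: "M \<in> carrier_mat p p \<Longrightarrow> zero_pad p m M \<in> carrier_mat (p + m) (p + m)"
  unfolding zero_pad_def by auto

lemma transpose_zero_pad:
  "M \<in> carrier_mat p p \<Longrightarrow> transpose_mat (zero_pad p m M) = zero_pad p m (transpose_mat M)"
  unfolding zero_pad_def by (subst transpose_four_block_mat[of _ p p _ m _ m]) auto

lemma zero_pad_inject:
  assumes "M \<in> carrier_mat p p" and "N \<in> carrier_mat p p" and eq: "zero_pad p m M = zero_pad p m N"
  shows "M = N"
proof (rule eq_matI)
  fix i j assume "i < dim_row N" "j < dim_col N"
  thus "M $$ (i,j) = N $$ (i,j)"
    using assms(1,2) arg_cong[OF eq, of "\<lambda>A. A $$ (i,j)"] unfolding zero_pad_def by auto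
qed (use assms in auto)

lemma symmetric_zero_pad_iff:
  assumes "M \<in> carrier_mat p p"
  shows "symmetric_mat (zero_pad p m M) \<longleftrightarrow> symmetric_mat M"
  unfolding symmetric_mat_def using assms zero_pad_inject[of "transpose_mat M" p M m]
  by (auto simp: transpose_zero_pad)

lemma SDC_zero_pad:
  assumes "SDC p S"
  shows "SDC (p + m) (zero_pad p m ` S)"
proof -
  obtain Q where S: "\<And>M. M \<in> S \<Longrightarrow> M \<in> carrier_mat p p \<and> symmetric_mat M"
    and Q: "Q \<in> carrier_mat p p" and Qinv: "invertible_mat Q"
    and diag: "\<And>M. M \<in> S \<Longrightarrow> diagonal_mat (transpose_mat Q * M * Q)"
    using assms unfolding SDC_def by blast
  obtain R where R: "R \<in> carrier_mat p p" and QR: "Q * R = 1\<^sub>m p"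
    using invertible_mat_obtain_inverse[OF Qinv Q] by blast
  let ?ext = "\<lambda>A :: real mat. four_block_mat A (0\<^sub>m p m) (0\<^sub>m m p) (1\<^sub>m m)"
  have "?ext Q * ?ext R = 1\<^sub>m (p + m)"
    using Q R QR by (subst mult_four_block_mat[of _ p p _ m _ m _ _ p _ m]) auto
  hence inv: "invertible_mat (?ext Q)"
    using Q R by (intro invertible_mat_of_right_inverse[of _ "p + m" "?ext R"]) auto
  have "transpose_mat (?ext Q) * zero_pad p m M * ?ext Q = zero_pad p m (transpose_mat Q * M * Q)"
    if "M \<in> S" for M
  proof -
    have M: "M \<in> carrier_mat p p" using S that by blast
    have "transpose_mat (?ext Q) = ?ext (transpose_mat Q)"
      using Q by (subst transpose_four_block_mat[of _ p p _ m _ m]) auto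
    moreover have "?ext (transpose_mat Q) * zero_pad p m M = zero_pad p m (transpose_mat Q * M)"
      unfolding zero_pad_def
      using Q M by (subst mult_four_block_mat[of _ p p _ m _ m _ _ p _ m]) auto
    moreover have "zero_pad p m (transpose_mat Q * M) * ?ext Q = zero_pad p m (transpose_mat Q * M * Q)"
      unfolding zero_pad_def
      using Q M by (subst mult_four_block_mat[of _ p p _ m _ m _ _ p _ m]) auto
    ultimately show ?thesis by simp
  qed
  moreover have "diagonal_mat (zero_pad p m (transpose_mat Q * M * Q))" if "M \<in> S" for M
    using diag[OF that] Q unfolding diagonal_mat_def zero_pad_def by auto
  ultimately show ?thesis
    unfolding SDC_def using inv S Q
    by (auto simp: symmetric_zero_pad_iff zero_pad_carrier intro!: bexI[of _ "?ext Q"])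
qed

text \<open>From left to right, restricting a diagonalizing matrix to its first \<open>p\<close> rows keeps all the
  congruences, and the invertible \<open>C\<close> tells which \<open>p\<close> of the columns to keep.\<close>

lemma SDC_zero_pad_iff:
  assumes S: "S \<subseteq> carrier_mat p p" and C: "C \<in> S" and Cinv: "invertible_mat C"
  shows "SDC (p + m) (zero_pad p m ` S) \<longleftrightarrow> SDC p S"
proof
  assume "SDC (p + m) (zero_pad p m ` S)"
  then obtain P where sym: "\<And>M. M \<in> S \<Longrightarrow> symmetric_mat (zero_pad p m M)"
    and P: "P \<in> carrier_mat (p + m) (p + m)" and Pinv: "invertible_mat P"
    and diag: "\<And>M. M \<in> S \<Longrightarrow> diagonal_mat (transpose_mat P * zero_pad p m M * P)"
    unfolding SDC_def by blast
  \<comment> \<open>The inclusion of the first \<open>p\<close> coordinates; blocks of width zero give access to block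
    multiplication.\<close>
  define J :: "real mat" where
    "J = four_block_mat (1\<^sub>m p) (0\<^sub>m p 0) (0\<^sub>m m p) (0\<^sub>m m 0)"
  have J: "J \<in> carrier_mat (p + m) p" 
    unfolding J_def using four_block_carrier_mat[of "1\<^sub>m p" p p "0\<^sub>m m 0" m 0] by simp
  have Jt: "transpose_mat J \<in> carrier_mat p (p + m)" using J by simp
  have Jt_eq: "transpose_mat J = four_block_mat (1\<^sub>m p) (0\<^sub>m p m) (0\<^sub>m 0 p) (0\<^sub>m 0 m)"
    unfolding J_def by (subst transpose_four_block_mat[of _ p p _ 0 _ m]) auto
  have JtJ: "transpose_mat J * J = 1\<^sub>m p"
    unfolding Jt_eq unfolding J_def
    by (subst mult_four_block_mat[of _ p p _ m _ 0 _ _ p _ 0]) (auto intro!: eq_matI)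
  have pad: "zero_pad p m M = J * M * transpose_mat J" if "M \<in> S" for M
  proof -
    have M: "M \<in> carrier_mat p p" using S that by blast
    have "M = four_block_mat M (0\<^sub>m p 0) (0\<^sub>m 0 p) (0\<^sub>m 0 0)"
      using M by (intro eq_matI) auto
    hence "J * M = four_block_mat M (0\<^sub>m p 0) (0\<^sub>m m p) (0\<^sub>m m 0)"
      unfolding J_def using M
      by (metis (no_types, lifting) M mult_four_block_mat[of "1\<^sub>m p" p p "0\<^sub>m p 0" 0 "0\<^sub>m m p" m "0\<^sub>m m 0" M p "0\<^sub>m p 0" 0 "0\<^sub>m 0 p" "0\<^sub>m 0 0"]
         left_mult_one_mat left_mult_zero_mat right_add_zero_mat right_mult_zero_mat one_carrier_mat zero_carrier_mat)
    thus ?thesis unfolding Jt_eq zero_pad_def using M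
      by (simp add: mult_four_block_mat[of _ p p _ 0 _ m _ _ p _ m])
  qed
  define X where "X = transpose_mat J * P"
  have X: "X \<in> carrier_mat p (p + m)" unfolding X_def using J P by auto
  obtain R where R: "R \<in> carrier_mat (p + m) (p + m)" and PR: "P * R = 1\<^sub>m (p + m)"
    using invertible_mat_obtain_inverse[OF Pinv P] by blast
  have "X * (R * J) = transpose_mat J * (P * R) * J"
    unfolding X_def using P R J Jt by (smt (verit) assoc_mult_mat mult_carrier_mat)
  hence XR: "X * (R * J) = 1\<^sub>m p" using PR JtJ J by simp
  have "transpose_mat X * M * X = transpose_mat P * zero_pad p m M * P" if "M \<in> S" for M
  proof -
    have M: "M \<in> carrier_mat p p" using S that by blast
    have Pt: "transpose_mat P \<in> carrier_mat (p + m) (p + m)" using P by simp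
    have "transpose_mat X = transpose_mat P * J"
      unfolding X_def using transpose_mult[OF Jt P] by simp
    thus ?thesis unfolding pad[OF that] X_def using P Pt J Jt M
      by (smt (verit) assoc_mult_mat mult_carrier_mat)
  qed
  hence "diagonal_mat (transpose_mat X * M * X)" if "M \<in> S" for M
    using diag that by simp
  moreover have "M \<in> carrier_mat p p \<and> symmetric_mat M" if "M \<in> S" for M
    using S sym[OF that] that symmetric_zero_pad_iff[of M p m] by blast
  ultimately show "SDC p S"
    using R J by (intro SDC_of_surjective_congruence[OF _ C Cinv X _ XR]) auto
next
  assume "SDC p S"
  thus "SDC (p + m) (zero_pad p m ` S)" by (rule SDC_zero_pad)
qed

section \<open>Vanishing of the off-diagonal block\<close>

text \<open>The kernel of the padded \<open>C11\<close> is the span of the last \<open>m\<close> basis vectors. The zero corner of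
  the other matrix makes this span isotropic for it, so the inclusion of kernels applies, and on
  this span the other matrix acts as \<open>C22\<close>.\<close>

lemma SDC_imp_off_diagonal_block_zero:
  fixes C11 C21 C22 :: "real mat"
  assumes C11: "C11 \<in> carrier_mat p p" and inv: "invertible_mat C11"
    and C21: "C21 \<in> carrier_mat p p" and C22: "C22 \<in> carrier_mat p m"
    and SDC: "SDC (p + m) {zero_pad p m C11,
                four_block_mat C21 C22 (transpose_mat C22) (0\<^sub>m m m)}"
  shows "C22 = 0\<^sub>m p m"
proof -
  let ?A = "zero_pad p m C11"
  let ?B = "four_block_mat C21 C22 (transpose_mat C22) (0\<^sub>m m m)"
  obtain K where K: "K \<in> carrier_mat p p" and KC: "K * C11 = 1\<^sub>m p"
    using invertible_mat_obtain_inverse[OF inv C11] by blast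
  obtain P where P: "P \<in> carrier_mat (p + m) (p + m)" "invertible_mat P"
    and DA: "diagonal_mat (transpose_mat P * ?A * P)"
    and DB: "diagonal_mat (transpose_mat P * ?B * P)"
    using SDC unfolding SDC_def by auto
  have A: "?A \<in> carrier_mat (p + m) (p + m)" using C11 by (rule zero_pad_carrier)
  have B: "?B \<in> carrier_mat (p + m) (p + m)" using C21 by auto
  have A_mult: "?A *\<^sub>v (u @\<^sub>v w) = (C11 *\<^sub>v u) @\<^sub>v 0\<^sub>v m"
    if "u \<in> carrier_vec p" "w \<in> carrier_vec m" for u w
    unfolding zero_pad_def
    using that C11 by (subst four_block_mat_mult_vec[of _ p p _ m _ m]) auto
  have B_mult: "?B *\<^sub>v (0\<^sub>v p @\<^sub>v w) = (C22 *\<^sub>v w) @\<^sub>v 0\<^sub>v m" if "w \<in> carrier_vec m" for w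
    using that C21 C22
    by (subst four_block_mat_mult_vec[of _ p p _ m _ m])
       (auto simp: mult_mat_zero_vec[of _ p p] mult_mat_zero_vec[of _ m p])
  have isotropic: "x \<bullet> (?B *\<^sub>v x) = 0"
    if x: "x \<in> carrier_vec (p + m)" and Ax: "?A *\<^sub>v x = 0\<^sub>v (p + m)" for x
  proof -
    define u w where "u = vec_first x p" and "w = vec_last x m"
    have u: "u \<in> carrier_vec p" and w: "w \<in> carrier_vec m" unfolding u_def w_def by auto
    have x_eq: "x = u @\<^sub>v w" unfolding u_def w_def using x by simp
    have "(C11 *\<^sub>v u) @\<^sub>v 0\<^sub>v m = 0\<^sub>v p @\<^sub>v 0\<^sub>v m"
      using Ax A_mult[OF u w] x_eq by auto
    hence "C11 *\<^sub>v u = 0\<^sub>v p" using C11 u by (subst (asm) append_vec_eq[of _ p]) auto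
    hence "u = 0\<^sub>v p" using assoc_mult_mat_vec[OF K C11 u] KC K u by (simp add: mult_mat_zero_vec)
    hence "x \<bullet> (?B *\<^sub>v x) = (0\<^sub>v p @\<^sub>v w) \<bullet> ((C22 *\<^sub>v w) @\<^sub>v 0\<^sub>v m)"
      using B_mult[OF w] x_eq by simp
    also have "\<dots> = 0\<^sub>v p \<bullet> (C22 *\<^sub>v w) + w \<bullet> 0\<^sub>v m"
      using C22 w by (intro scalar_prod_append[of _ p _ m]) auto
    finally show ?thesis using C22 w by simp
  qed
  have "C22 *\<^sub>v w = 0\<^sub>v p" if w: "w \<in> carrier_vec m" for w
  proof -
    have "?A *\<^sub>v (0\<^sub>v p @\<^sub>v w) = 0\<^sub>v (p + m)"
      using A_mult[of "0\<^sub>v p" w] w C11 by auto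
    hence "?B *\<^sub>v (0\<^sub>v p @\<^sub>v w) = 0\<^sub>v (p + m)"
      using simultaneous_diagonal_ker_subset[OF A B P DA DB isotropic, of "0\<^sub>v p @\<^sub>v w"] w
      by auto
    hence "(C22 *\<^sub>v w) @\<^sub>v 0\<^sub>v m = 0\<^sub>v p @\<^sub>v 0\<^sub>v m"
      using B_mult[OF w] by auto
    thus ?thesis using C22 w by (subst (asm) append_vec_eq[of _ p]) auto
  qed
  hence "col C22 j = 0\<^sub>v p" if "j < m" for j
    using mult_mat_vec_unit_vec[OF C22 that] by simp
  thus ?thesis using C22 by (intro mat_col_eqI) auto
qed

theorem lemma11:
  fixes n p :: nat
    and C1 C2 U1 C1bar C2bar C11 C21 C22 :: "real mat"
  assumes "C1 \<in> carrier_mat n n" and "symmetric_mat C1" and "\<not> invertible_mat C1"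
    and "C2 \<in> carrier_mat n n" and "symmetric_mat C2" and "\<not> invertible_mat C2"
    and "p = vec_space.rank n C1" and "p < n"
    and "U1 \<in> carrier_mat n n" and "invertible_mat U1"
    and "C1bar = transpose_mat U1 * C1 * U1"
    and "C2bar = transpose_mat U1 * C2 * U1"
    and "C11 \<in> carrier_mat p p" and "diagonal_mat C11" and "invertible_mat C11"
    and "C21 \<in> carrier_mat p p"
    and "C22 \<in> carrier_mat p (n - p)"
    and "C1bar = four_block_mat C11 (0\<^sub>m p (n - p)) (0\<^sub>m (n - p) p) (0\<^sub>m (n - p) (n - p))"
    and "C2bar = four_block_mat C21 C22 (transpose_mat C22) (0\<^sub>m (n - p) (n - p))"
  shows "SDC n {C1bar, C2bar} \<longleftrightarrow> SDC p {C11, C21} \<and> C22 = 0\<^sub>m p (n - p)"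
proof -
  define m where "m = n - p"
  have n: "n = p + m" using assms(8) m_def by simp
  note C11 = assms(13) and inv = assms(15) and C21 = assms(16) and C22 = assms(17)[folded m_def]
  have C1bar: "C1bar = zero_pad p m C11" using assms(18) by (simp add: zero_pad_def m_def)
  have C2bar: "C2bar = four_block_mat C21 C22 (transpose_mat C22) (0\<^sub>m m m)"
    using assms(19) by (simp add: m_def)
  have iff: "SDC n {C1bar, C2bar} \<longleftrightarrow> SDC p {C11, C21}" if "C22 = 0\<^sub>m p m"
  proof -
    have "C2bar = zero_pad p m C21" using C2bar that by (simp add: zero_pad_def)
    thus ?thesis
      using SDC_zero_pad_iff[of "{C11, C21}" p C11 m] C11 C21 inv C1bar n by simp
  qed
  have "C22 = 0\<^sub>m p m" if "SDC n {C1bar, C2bar}"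
    using SDC_imp_off_diagonal_block_zero[OF C11 inv C21 C22] that C1bar C2bar n by simp
  with iff show ?thesis unfolding m_def by blast
qed

end
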